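(* Let $n\ge 1$, let $\Psi^{1}(u),\dots,\Psi^n(u)\in\mathbb R((u^1,\dots,u^n))$ be arbitrary formal Laurent series (or a set of $n$ smooth functions), and let $\alpha,\beta\in\mathbb R$ be arbitrary. Let $\Theta^1(u),\dots,\Theta^n(u)\in\mathbb R((u^1,\dots,u^n))$ be Laurent series (respectively, smooth functions) satisfying the system of linear partial differential equations $$\sum_{s=1}^n\left(\Psi^s(u)\frac{\partial \Theta^i(u)}{\partial u^s}-\Theta^s(u)\frac{\partial \Psi^i(u)}{\partial u^s}\right)=\alpha\,\Theta^i(u)+\beta\,\Psi^i(u),\qquad i=1,\dots,n.$$ Then $$\varphi^{ij}(u,v)=\Theta^i(u)\Psi^j(v)-\Theta^j(v)\Psi^i(u),\qquad i,j=1,\dots,n,$$ is a solution of the classical Yang--Baxter equation (CYBE) for the Lie algebra $W_n$ of formal vector fields on $\mathbb R^n$.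
   Context: Notation: $u=(u^1,\dots,u^n)$, $v=(v^1,\dots,v^n)$, $w=(w^1,\dots,w^n)$. $\mathbb R((u^1,\dots,u^n))$ denotes formal Laurent series in which the exponents of each variable are bounded below. A solution of the CYBE for $W_n$ is a family $\varphi^{ij}(u,v)$, $i,j=1,\dots,n$, of formal power series (or formal Laurent series, or smooth functions) with $\varphi^{ij}(u,v)=-\varphi^{ji}(v,u)$ such that for all $i,j,k\in\{1,\dots,n\}$, with summation over the repeated index $s=1,\dots,n$ understood, $$\begin{aligned}&\varphi^{ks}(w,u)\frac{\partial \varphi^{ij}(u,v)}{\partial u^s}+\varphi^{sk}(v,w)\frac{\partial \varphi^{ji}(v,u)}{\partial v^s}+\varphi^{is}(u,v)\frac{\partial \varphi^{jk}(v,w)}{\partial v^s}\\&+\varphi^{si}(w,u)\frac{\partial \varphi^{kj}(w,v)}{\partial w^s}+\varphi^{js}(v,w)\frac{\partial \varphi^{ki}(w,u)}{\partial w^s}+\varphi^{sj}(u,v)\frac{\partial \varphi^{ik}(u,w)}{\partial u^s}=0.\end{aligned}$$ *)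

theory Defs
  imports "HOL-Analysis.Analysis"
begin

section \<open>Formal Laurent series in several variables\<close>

text \<open>
  The elements of \<open>'v laurent\<close> are the formal series with real coefficients in the variables
  indexed by \<open>'v\<close>, with exponents in \<open>int^'v\<close>, in which the exponents of each variable are
  bounded below (recall that \<open>\<le>\<close> on \<open>int^'v\<close> is componentwise).
\<close>

typedef (overloaded) ('v::finite) laurent =
  "{f :: (int^'v) \<Rightarrow> real. \<exists>N. \<forall>m. f m \<noteq> 0 \<longrightarrow> N \<le> m}"
  morphisms lcoeff Abs_laurent
  by (rule exI[of _ "\<lambda>_. 0"]) simp

setup_lifting type_definition_laurent

lemma laurent_eqI: "(\<And>m. lcoeff f m = lcoeff g m) \<Longrightarrow> f = g"
  by (metis ext lcoeff_inject)

lemma lcoeff_bound: obtains N where "\<And>m. lcoeff f m \<noteq> 0 \<Longrightarrow> N \<le> m"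
  using lcoeff[of f] by blast

lemma finite_int_vec_Icc: "finite {a..b :: int^'v::finite}"
proof -
  have "{a..b} \<subseteq> vec_lambda ` (\<Pi>\<^sub>E i\<in>UNIV. {a $ i..b $ i})"
  proof
    fix x assume "x \<in> {a..b}"
    then have "(\<lambda>i. x $ i) \<in> (\<Pi>\<^sub>E i\<in>UNIV. {a $ i..b $ i})"
      by (auto simp: less_eq_vec_def)
    moreover have "x = vec_lambda (\<lambda>i. x $ i)" by simp
    ultimately show "x \<in> vec_lambda ` (\<Pi>\<^sub>E i\<in>UNIV. {a $ i..b $ i})" by blast
  qed
  then show ?thesis
    by (rule finite_subset) (intro finite_imageI finite_PiE, auto)
qed

lemma add_mono_vec: "(a :: int^'v::finite) \<le> b \<Longrightarrow> c \<le> d \<Longrightarrow> a + c \<le> b + d"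
  by (auto simp: less_eq_vec_def intro: add_mono)

instantiation laurent :: (finite) comm_ring_1
begin

lift_definition zero_laurent :: "'a laurent" is "\<lambda>_. 0" by simp

lift_definition one_laurent :: "'a laurent" is "\<lambda>m. if m = 0 then 1 else 0"
  by (rule exI[of _ 0]) auto

lift_definition plus_laurent :: "'a laurent \<Rightarrow> 'a laurent \<Rightarrow> 'a laurent" is "\<lambda>f g m. f m + g m"
proof -
  fix f g :: "int^'a \<Rightarrow> real"
  assume "\<exists>N. \<forall>m. f m \<noteq> 0 \<longrightarrow> N \<le> m" "\<exists>N. \<forall>m. g m \<noteq> 0 \<longrightarrow> N \<le> m"
  then obtain M N where "\<And>m. f m \<noteq> 0 \<Longrightarrow> M \<le> m" "\<And>m. g m \<noteq> 0 \<Longrightarrow> N \<le> m" by blast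
  then have "\<forall>m. f m + g m \<noteq> 0 \<longrightarrow> (\<chi> i. min (M $ i) (N $ i)) \<le> m"
    by (auto simp: less_eq_vec_def) (metis add_0 min.coboundedI1 min.coboundedI2)
  then show "\<exists>N. \<forall>m. f m + g m \<noteq> 0 \<longrightarrow> N \<le> m" by blast
qed

lift_definition uminus_laurent :: "'a laurent \<Rightarrow> 'a laurent" is "\<lambda>f m. - f m" by simp

definition minus_laurent :: "'a laurent \<Rightarrow> 'a laurent \<Rightarrow> 'a laurent" where
  "f - g = f + (- g)" for f g :: "'a laurent"

text \<open>The sum below is finite because the exponents of both factors are bounded below.\<close>

lift_definition times_laurent :: "'a laurent \<Rightarrow> 'a laurent \<Rightarrow> 'a laurent" is
  "\<lambda>f g m. \<Sum>a | f a \<noteq> 0 \<and> g (m - a) \<noteq> 0. f a * g (m - a)"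
proof -
  fix f g :: "int^'a \<Rightarrow> real"
  assume "\<exists>N. \<forall>m. f m \<noteq> 0 \<longrightarrow> N \<le> m" "\<exists>N. \<forall>m. g m \<noteq> 0 \<longrightarrow> N \<le> m"
  then obtain M N where *: "\<And>m. f m \<noteq> 0 \<Longrightarrow> M \<le> m" "\<And>m. g m \<noteq> 0 \<Longrightarrow> N \<le> m" by blast
  have "M + N \<le> m" if nz: "(\<Sum>a | f a \<noteq> 0 \<and> g (m - a) \<noteq> 0. f a * g (m - a)) \<noteq> 0" for m
  proof -
    obtain a where "f a \<noteq> 0" "g (m - a) \<noteq> 0"
      using sum.not_neutral_contains_not_neutral[OF nz] by auto
    then have "M + N \<le> a + (m - a)" by (intro add_mono_vec *)
    then show ?thesis by simp
  qed
  then show "\<exists>N. \<forall>m. (\<Sum>a | f a \<noteq> 0 \<and> g (m - a) \<noteq> 0. f a * g (m - a)) \<noteq> 0 \<longrightarrow> N \<le> m"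
    by blast
qed

lemma lcoeff_times:
  assumes "finite S" "\<And>a. lcoeff f a \<noteq> 0 \<Longrightarrow> lcoeff g (m - a) \<noteq> 0 \<Longrightarrow> a \<in> S"
  shows "lcoeff (f * g) m = (\<Sum>a\<in>S. lcoeff f a * lcoeff g (m - a))"
  unfolding times_laurent.rep_eq
  by (rule sum.mono_neutral_left) (use assms in auto)

lemma lcoeff_times_Icc:
  assumes "\<And>m. lcoeff f m \<noteq> 0 \<Longrightarrow> M \<le> m" "\<And>m. lcoeff g m \<noteq> 0 \<Longrightarrow> N \<le> m"
    and "M' \<le> M" "m - N \<le> N'"
  shows "lcoeff (f * g) m = (\<Sum>a\<in>{M'..N'}. lcoeff f a * lcoeff g (m - a))"
proof (rule lcoeff_times[OF finite_int_vec_Icc])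
  fix a assume "lcoeff f a \<noteq> 0" "lcoeff g (m - a) \<noteq> 0"
  with assms(1,2) have "M \<le> a" "N \<le> m - a" by auto
  with assms(3,4) show "a \<in> {M'..N'}"
    by (auto simp: less_eq_vec_def) (smt (verit, best))+
qed

instance
proof
  fix f g h :: "'a laurent"
  obtain F where F: "\<And>m. lcoeff f m \<noteq> 0 \<Longrightarrow> F \<le> m" using lcoeff_bound[of f] by blast
  obtain G where G: "\<And>m. lcoeff g m \<noteq> 0 \<Longrightarrow> G \<le> m" using lcoeff_bound[of g] by blast
  obtain H where H: "\<And>m. lcoeff h m \<noteq> 0 \<Longrightarrow> H \<le> m" using lcoeff_bound[of h] by blast
  show "f + g + h = f + (g + h)" by transfer (simp add: algebra_simps)
  show "f + g = g + f" by transfer (simp add: algebra_simps)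
  show "0 + f = f" by transfer simp
  show "- f + f = 0" by transfer simp
  show "f - g = f + - g" by (simp add: minus_laurent_def)
  show "(0::'a laurent) \<noteq> 1" by transfer (metis zero_neq_one)
  show "f * g = g * f"
  proof (rule laurent_eqI)
    fix m
    show "lcoeff (f * g) m = lcoeff (g * f) m"
      unfolding times_laurent.rep_eq
      by (rule sum.reindex_bij_witness[of _ "\<lambda>a. m - a" "\<lambda>a. m - a"]) auto
  qed
  show "1 * f = f"
  proof (rule laurent_eqI)
    fix m
    have "lcoeff (1 * f) m = (\<Sum>a\<in>{0}. lcoeff 1 a * lcoeff f (m - a))"
      by (rule lcoeff_times) (auto simp: one_laurent.rep_eq split: if_splits)
    then show "lcoeff (1 * f) m = lcoeff f m" by (simp add: one_laurent.rep_eq)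
  qed
  show "(f + g) * h = f * h + g * h"
  proof (rule laurent_eqI)
    fix m
    define M where "M = (\<chi> i. min (F $ i) (G $ i))"
    have MF: "M \<le> F" and MG: "M \<le> G" by (auto simp: M_def less_eq_vec_def)
    have FG: "M \<le> a" if "lcoeff (f + g) a \<noteq> 0" for a
      using that F[of a] G[of a] order_trans[OF MF] order_trans[OF MG]
      by (auto simp: plus_laurent.rep_eq) fastforce
    have "lcoeff ((f + g) * h) m = (\<Sum>a\<in>{M..m - H}. lcoeff (f + g) a * lcoeff h (m - a))"
      by (rule lcoeff_times_Icc[OF FG H]) auto
    moreover have "lcoeff (f * h) m = (\<Sum>a\<in>{M..m - H}. lcoeff f a * lcoeff h (m - a))"
      by (rule lcoeff_times_Icc[OF F H MF]) auto
    moreover have "lcoeff (g * h) m = (\<Sum>a\<in>{M..m - H}. lcoeff g a * lcoeff h (m - a))"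
      by (rule lcoeff_times_Icc[OF G H MG]) auto
    ultimately show "lcoeff ((f + g) * h) m = lcoeff (f * h + g * h) m"
      by (simp add: plus_laurent.rep_eq sum.distrib distrib_right)
  qed
  show "f * g * h = f * (g * h)"
  proof (rule laurent_eqI)
    fix m
    have FG: "F + G \<le> a" if nz: "lcoeff (f * g) a \<noteq> 0" for a
    proof -
      obtain b where "lcoeff f b \<noteq> 0" "lcoeff g (a - b) \<noteq> 0"
        using nz unfolding times_laurent.rep_eq
        by (elim sum.not_neutral_contains_not_neutral) auto
      then have "F + G \<le> b + (a - b)" by (intro add_mono_vec F G)
      then show ?thesis by simp
    qed
    have GH: "G + H \<le> a" if nz: "lcoeff (g * h) a \<noteq> 0" for a
    proof -
      obtain b where "lcoeff g b \<noteq> 0" "lcoeff h (a - b) \<noteq> 0"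
        using nz unfolding times_laurent.rep_eq
        by (elim sum.not_neutral_contains_not_neutral) auto
      then have "G + H \<le> b + (a - b)" by (intro add_mono_vec G H)
      then show ?thesis by simp
    qed
    define A where "A = {F..m - (G + H)}"
    define X where "X = {F + G..m - H}"
    have [simp]: "finite A" "finite X" by (simp_all add: A_def X_def finite_int_vec_Icc)
    have "lcoeff (f * g * h) m = (\<Sum>x\<in>X. lcoeff (f * g) x * lcoeff h (m - x))"
      unfolding X_def by (rule lcoeff_times_Icc[OF FG H]) auto
    also have "\<dots> = (\<Sum>x\<in>X. (\<Sum>a\<in>A. lcoeff f a * lcoeff g (x - a)) * lcoeff h (m - x))"
    proof (intro sum.cong refl arg_cong2[where f = "(*)"])
      fix x assume "x \<in> X"
      then have "x - G \<le> m - (G + H)"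
        by (auto simp: X_def less_eq_vec_def algebra_simps)
      then show "lcoeff (f * g) x = (\<Sum>a\<in>A. lcoeff f a * lcoeff g (x - a))"
        unfolding A_def by (intro lcoeff_times_Icc[OF F G]) auto
    qed
    also have "\<dots> = (\<Sum>a\<in>A. lcoeff f a * (\<Sum>x\<in>X. lcoeff g (x - a) * lcoeff h (m - x)))"
      by (simp add: sum_distrib_left sum_distrib_right sum.swap[of _ X A] mult.assoc)
    also have "\<dots> = (\<Sum>a\<in>A. lcoeff f a * lcoeff (g * h) (m - a))"
    proof (intro sum.cong refl)
      fix a
      show "lcoeff f a * (\<Sum>x\<in>X. lcoeff g (x - a) * lcoeff h (m - x)) =
        lcoeff f a * lcoeff (g * h) (m - a)"
      proof (cases "lcoeff f a = 0")
        case False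
        have "lcoeff (g * h) (m - a) =
          (\<Sum>y\<in>(\<lambda>x. x - a) ` X. lcoeff g y * lcoeff h (m - a - y))"
        proof (rule lcoeff_times)
          fix y assume "lcoeff g y \<noteq> 0" "lcoeff h (m - a - y) \<noteq> 0"
          then have "G \<le> y" "H \<le> m - a - y" by (auto intro: G H)
          moreover have "F \<le> a" using False by (rule F)
          ultimately have "y + a \<in> X"
            unfolding X_def less_eq_vec_def atLeastAtMost_iff
            by (auto simp: algebra_simps) (smt (verit, best))+
          then show "y \<in> (\<lambda>x. x - a) ` X" by force
        qed simp
        also have "\<dots> = (\<Sum>x\<in>X. lcoeff g (x - a) * lcoeff h (m - x))"
          by (subst sum.reindex) (auto simp: inj_on_def)
        finally show ?thesis by simp
      qed simp
    qed
    also have "\<dots> = lcoeff (f * (g * h)) m"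
      unfolding A_def by (rule lcoeff_times_Icc[OF F GH, symmetric]) auto
    finally show "lcoeff (f * g * h) m = lcoeff (f * (g * h)) m" .
  qed
qed

end

instantiation laurent :: (finite) real_algebra_1
begin

lift_definition scaleR_laurent :: "real \<Rightarrow> 'a laurent \<Rightarrow> 'a laurent" is "\<lambda>c f m. c * f m"
  by auto

instance
proof
  fix a b :: real and f g :: "'a laurent"
  show "a *\<^sub>R (f + g) = a *\<^sub>R f + a *\<^sub>R g" by transfer (simp add: algebra_simps)
  show "(a + b) *\<^sub>R f = a *\<^sub>R f + b *\<^sub>R f" by transfer (simp add: algebra_simps)
  show "a *\<^sub>R b *\<^sub>R f = (a * b) *\<^sub>R f" by transfer (simp add: algebra_simps)
  show "1 *\<^sub>R f = f" by transfer simp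
  show left: "a *\<^sub>R f * g = a *\<^sub>R (f * g)" for f g :: "'a laurent"
    by (rule laurent_eqI, cases "a = 0")
      (simp_all add: times_laurent.rep_eq scaleR_laurent.rep_eq sum_distrib_left mult.assoc)
  show "f * a *\<^sub>R g = a *\<^sub>R (f * g)"
    using left[of g f] by (simp add: mult.commute)
qed

end

lift_definition lpartial :: "'v::finite \<Rightarrow> 'v laurent \<Rightarrow> 'v laurent" is
  "\<lambda>s f m. of_int (m $ s + 1) * f (m + axis s 1)"
proof -
  fix s and f :: "int^'v \<Rightarrow> real"
  assume "\<exists>N. \<forall>m. f m \<noteq> 0 \<longrightarrow> N \<le> m"
  then obtain N where N: "\<And>m. f m \<noteq> 0 \<Longrightarrow> N \<le> m" by blast
  have "N - axis s 1 \<le> m" if "of_int (m $ s + 1) * f (m + axis s 1) \<noteq> 0" for m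
  proof -
    have "N \<le> m + axis s 1" using that by (intro N) auto
    then show ?thesis by (simp add: less_eq_vec_def algebra_simps)
  qed
  then show "\<exists>N. \<forall>m. of_int (m $ s + 1) * f (m + axis s 1) \<noteq> 0 \<longrightarrow> N \<le> m" by blast
qed

text \<open>
  For an injective map \<open>\<rho>\<close>, \<open>lrename \<rho> f\<close> is the series \<open>f\<close> with its variable \<open>i\<close> renamed to
  \<open>\<rho> i\<close>, viewed as a series in all the variables \<open>'w\<close>; variables outside the range of \<open>\<rho>\<close>
  do not occur in it. The definition is meaningful for injective \<open>\<rho>\<close> only.
\<close>

lift_definition lrename :: "('v::finite \<Rightarrow> 'w::finite) \<Rightarrow> 'v laurent \<Rightarrow> 'w laurent" is
  "\<lambda>\<rho> f m. if \<forall>j. j \<notin> range \<rho> \<longrightarrow> m $ j = 0 then f (\<chi> i. m $ \<rho> i) else 0"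
proof -
  fix \<rho> :: "'v \<Rightarrow> 'w" and f :: "int^'v \<Rightarrow> real"
  assume "\<exists>N. \<forall>m. f m \<noteq> 0 \<longrightarrow> N \<le> m"
  then obtain N where N: "\<And>m. f m \<noteq> 0 \<Longrightarrow> N \<le> m" by blast
  define K where "K = (\<chi> j::'w. if j \<in> range \<rho> then N $ inv \<rho> j else 0)"
  have "K \<le> m" if "\<forall>j. j \<notin> range \<rho> \<longrightarrow> m $ j = 0" "f (\<chi> i. m $ \<rho> i) \<noteq> 0" for m
    unfolding less_eq_vec_def
  proof
    fix j
    show "K $ j \<le> m $ j"
    proof (cases "j \<in> range \<rho>")
      case True
      have "N $ inv \<rho> j \<le> (\<chi> i. m $ \<rho> i) $ inv \<rho> j"
        using N[OF that(2)] unfolding less_eq_vec_def by blast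
      with True show ?thesis by (simp add: K_def f_inv_into_f)
    qed (use that in \<open>simp add: K_def\<close>)
  qed
  then show "\<exists>N. \<forall>m. (if \<forall>j. j \<notin> range \<rho> \<longrightarrow> m $ j = 0 then f (\<chi> i. m $ \<rho> i) else 0) \<noteq> 0 \<longrightarrow> N \<le> m"
    by (intro exI[of _ K]) auto
qed


section \<open>The classical Yang--Baxter equation for \<open>W\<^sub>n\<close>\<close>

text \<open>
  A family \<open>\<phi>\<^sup>i\<^sup>j(u,v)\<close> of Laurent series is modelled by series in the variables \<open>'n + 'n\<close>, where
  \<open>Inl s\<close> stands for \<open>u\<^sup>s\<close> and \<open>Inr s\<close> for \<open>v\<^sup>s\<close>. The equation itself lives in the ring of series
  in the three groups of variables \<open>u, v, w\<close>; there \<open>P i j a b\<close> is \<open>\<phi>\<^sup>i\<^sup>j(a,b)\<close>.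
\<close>

definition laurent_CYBE_solution :: "('n::finite \<Rightarrow> 'n \<Rightarrow> ('n + 'n) laurent) \<Rightarrow> bool" where
  "laurent_CYBE_solution \<phi> \<longleftrightarrow>
    (\<forall>i j. \<phi> i j = - lrename (case_sum Inr Inl) (\<phi> j i)) \<and>
    (\<forall>i j k.
      let P = (\<lambda>i j a b. lrename (case_sum a b) (\<phi> i j));
          u = (\<lambda>s. Inl s) :: 'n \<Rightarrow> 'n + 'n + 'n;
          v = (\<lambda>s. Inr (Inl s)) :: 'n \<Rightarrow> 'n + 'n + 'n;
          w = (\<lambda>s. Inr (Inr s)) :: 'n \<Rightarrow> 'n + 'n + 'n
      in (\<Sum>s\<in>UNIV.
            P k s w u * lpartial (u s) (P i j u v)
          + P s k v w * lpartial (v s) (P j i v u)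
          + P i s u v * lpartial (v s) (P j k v w)
          + P s i w u * lpartial (w s) (P k j w v)
          + P j s v w * lpartial (w s) (P k i w u)
          + P s j u v * lpartial (u s) (P i k u w)) = 0)"

primrec C_diff_on :: "nat \<Rightarrow> 'a::euclidean_space set \<Rightarrow> ('a \<Rightarrow> real) \<Rightarrow> bool" where
  "C_diff_on 0 S f \<longleftrightarrow> continuous_on S f"
| "C_diff_on (Suc k) S f \<longleftrightarrow>
    (\<forall>x\<in>S. f differentiable at x) \<and>
    (\<forall>h. C_diff_on k S (\<lambda>x. frechet_derivative f (at x) h))"

text \<open>Intended for open sets \<open>S\<close>.\<close>

definition smooth_on :: "'a::euclidean_space set \<Rightarrow> ('a \<Rightarrow> real) \<Rightarrow> bool" where
  "smooth_on S f \<longleftrightarrow> (\<forall>k. C_diff_on k S f)"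

definition partial :: "'n::finite \<Rightarrow> (real^'n \<Rightarrow> real) \<Rightarrow> real^'n \<Rightarrow> real" where
  "partial s f x = frechet_derivative f (at x) (axis s 1)"

definition smooth_CYBE_solution ::
    "(real^'n) set \<Rightarrow> ('n::finite \<Rightarrow> 'n \<Rightarrow> real^'n \<Rightarrow> real^'n \<Rightarrow> real) \<Rightarrow> bool" where
  "smooth_CYBE_solution U \<phi> \<longleftrightarrow>
    (\<forall>i j. smooth_on (U \<times> U) (\<lambda>(u, v). \<phi> i j u v)) \<and>
    (\<forall>i j. \<forall>u\<in>U. \<forall>v\<in>U. \<phi> i j u v = - \<phi> j i v u) \<and>
    (\<forall>i j k. \<forall>u\<in>U. \<forall>v\<in>U. \<forall>w\<in>U.
      (\<Sum>s\<in>UNIV.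
          \<phi> k s w u * partial s (\<lambda>u. \<phi> i j u v) u
        + \<phi> s k v w * partial s (\<lambda>v. \<phi> j i v u) v
        + \<phi> i s u v * partial s (\<lambda>v. \<phi> j k v w) v
        + \<phi> s i w u * partial s (\<lambda>w. \<phi> k j w v) w
        + \<phi> j s v w * partial s (\<lambda>w. \<phi> k i w u) w
        + \<phi> s j u v * partial s (\<lambda>u. \<phi> i k u w) u) = 0)"

end

theory Submission
  imports Defs
begin

text \<open>
  Write \<open>E i u\<close> for the value at \<open>u\<close> of the \<open>i\<close>-th component of the bracket of \<open>\<Psi>\<close> and \<open>\<Theta>\<close>,
  that is \<open>\<Sum>s. \<Psi> s * \<partial>\<^sub>s (\<Theta> i) - \<Theta> s * \<partial>\<^sub>s (\<Psi> i)\<close>. In the Yang--Baxter equation the two terms that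
  contain derivatives with respect to \<open>u\<close> add up to \<open>E i u * (\<Theta> k w * \<Psi> j v - \<Theta> j v * \<Psi> k w)\<close>:
  the terms in which a field is differentiated along itself cancel (\<open>CYBE_terms_one_point\<close>). The
  terms with derivatives with respect to \<open>v\<close> and \<open>w\<close> behave likewise, with \<open>(u, i)\<close>, \<open>(v, j)\<close>,
  \<open>(w, k)\<close> permuted cyclically. Once \<open>E\<close> is replaced by \<open>\<alpha> \<Theta> + \<beta> \<Psi>\<close>, the three contributions are,
  up to sign, the expansion of the determinant with rows \<open>\<alpha> \<Theta> + \<beta> \<Psi>, \<Theta>, \<Psi>\<close>, whose columns are
  the \<open>i\<close>-th, \<open>j\<close>-th and \<open>k\<close>-th components at \<open>u\<close>, \<open>v\<close> and \<open>w\<close>. It vanishes because the rows are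
  linearly dependent (\<open>CYBE_of_bracket_relation\<close>).

  This argument is purely algebraic and serves both cases. What remains for Laurent series is that
  renaming the variables injectively is an algebra homomorphism that commutes with partial
  derivatives, and that partial derivatives obey the Leibniz rule. For functions, what remains is
  the differentiation of \<open>\<phi>\<close> and its smoothness on \<open>U \<times> U\<close>, for which smoothness is shown to be
  preserved by differences, products and composition with linear maps.
\<close>

section \<open>The algebraic identity\<close>

text \<open>
  \<open>T, P\<close> are the components of \<open>\<Theta>, \<Psi>\<close> at one point and \<open>dT s, dP s\<close> the derivatives of one
  component of each; \<open>Tj, Pj\<close> and \<open>Tk, Pk\<close> are components at the two other points. The products
  \<open>T s * dT s\<close> and \<open>P s * dP s\<close> occur with opposite signs in the two summands.
\<close>

lemma CYBE_terms_one_point: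
  fixes T P dT dP :: "'n::finite \<Rightarrow> 'a::comm_ring_1"
  shows "(\<Sum>s\<in>UNIV. (Tk * P s - T s * Pk) * (dT s * Pj - Tj * dP s)
                  + (T s * Pj - Tj * P s) * (dT s * Pk - Tk * dP s))
       = (\<Sum>s\<in>UNIV. P s * dT s - T s * dP s) * (Tk * Pj - Tj * Pk)"
proof -
  have "(Tk * P s - T s * Pk) * (dT s * Pj - Tj * dP s)
      + (T s * Pj - Tj * P s) * (dT s * Pk - Tk * dP s)
    = (P s * dT s - T s * dP s) * (Tk * Pj - Tj * Pk)" for s
    by (simp add: algebra_simps)
  then show ?thesis by (simp add: sum_distrib_right)
qed

lemma CYBE_of_bracket_relation:
  fixes Tu Pu Tv Pv Tw Pw :: "'n::finite \<Rightarrow> 'a::{comm_ring_1,real_algebra_1}"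
  assumes u: "(\<Sum>s\<in>UNIV. Pu s * dTu s - Tu s * dPu s) = \<alpha> *\<^sub>R Tu i + \<beta> *\<^sub>R Pu i"
    and v: "(\<Sum>s\<in>UNIV. Pv s * dTv s - Tv s * dPv s) = \<alpha> *\<^sub>R Tv j + \<beta> *\<^sub>R Pv j"
    and w: "(\<Sum>s\<in>UNIV. Pw s * dTw s - Tw s * dPw s) = \<alpha> *\<^sub>R Tw k + \<beta> *\<^sub>R Pw k"
  shows "(\<Sum>s\<in>UNIV.
            (Tw k * Pu s - Tu s * Pw k) * (dTu s * Pv j - Tv j * dPu s)
          + (Tv s * Pw k - Tw k * Pv s) * (dTv s * Pu i - Tu i * dPv s)
          + (Tu i * Pv s - Tv s * Pu i) * (dTv s * Pw k - Tw k * dPv s)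
          + (Tw s * Pu i - Tu i * Pw s) * (dTw s * Pv j - Tv j * dPw s)
          + (Tv j * Pw s - Tw s * Pv j) * (dTw s * Pu i - Tu i * dPw s)
          + (Tu s * Pv j - Tv j * Pu s) * (dTu s * Pw k - Tw k * dPu s)) = 0"
    (is "?lhs = 0")
proof -
  have "?lhs =
      (\<Sum>s\<in>UNIV. (Tw k * Pu s - Tu s * Pw k) * (dTu s * Pv j - Tv j * dPu s)
               + (Tu s * Pv j - Tv j * Pu s) * (dTu s * Pw k - Tw k * dPu s))
    + (\<Sum>s\<in>UNIV. (Tu i * Pv s - Tv s * Pu i) * (dTv s * Pw k - Tw k * dPv s)
               + (Tv s * Pw k - Tw k * Pv s) * (dTv s * Pu i - Tu i * dPv s))
    + (\<Sum>s\<in>UNIV. (Tv j * Pw s - Tw s * Pv j) * (dTw s * Pu i - Tu i * dPw s)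
               + (Tw s * Pu i - Tu i * Pw s) * (dTw s * Pv j - Tv j * dPw s))"
    by (simp only: sum.distrib add.assoc add.commute add.left_commute)
  also have "\<dots> = (\<alpha> *\<^sub>R Tu i + \<beta> *\<^sub>R Pu i) * (Tw k * Pv j - Tv j * Pw k)
    + (\<alpha> *\<^sub>R Tv j + \<beta> *\<^sub>R Pv j) * (Tu i * Pw k - Tw k * Pu i)
    + (\<alpha> *\<^sub>R Tw k + \<beta> *\<^sub>R Pw k) * (Tv j * Pu i - Tu i * Pv j)"
    unfolding CYBE_terms_one_point u v w ..
  also have "\<dots> = 0"
    by (simp add: algebra_simps)
  finally show ?thesis .
qed

section \<open>Calculus of Laurent series\<close>

lemma lcoeff_minus: "lcoeff (f - g) m = lcoeff f m - lcoeff g m"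
  unfolding minus_laurent_def plus_laurent.rep_eq uminus_laurent.rep_eq by simp

lemma lpartial_minus: "lpartial s (f - g) = lpartial s f - lpartial s g"
  by (rule laurent_eqI) (simp add: lcoeff_minus lpartial.rep_eq algebra_simps)

lemma lpartial_mult: "lpartial s (f * g) = lpartial s f * g + f * lpartial s g"
proof (rule laurent_eqI)
  fix m
  obtain F where F: "\<And>m. lcoeff f m \<noteq> 0 \<Longrightarrow> F \<le> m" using lcoeff_bound[of f] by blast
  obtain G where G: "\<And>m. lcoeff g m \<noteq> 0 \<Longrightarrow> G \<le> m" using lcoeff_bound[of g] by blast
  define e :: "int^'a" where "e = axis s 1"
  have e: "e $ s = 1" by (simp add: e_def)
  define S where "S = {F..m + e - G}"
  have S: "a \<in> S" if "lcoeff f a \<noteq> 0" "lcoeff g (m + e - a) \<noteq> 0" for a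
    using F[OF that(1)] G[OF that(2)] by (auto simp: S_def less_eq_vec_def algebra_simps)
  have fin: "finite S" by (simp add: S_def finite_int_vec_Icc)
  have 1: "lcoeff (f * g) (m + e) = (\<Sum>a\<in>S. lcoeff f a * lcoeff g (m + e - a))"
    by (rule lcoeff_times[OF fin]) (rule S)
  have "lcoeff (lpartial s f * g) m =
      (\<Sum>a\<in>(\<lambda>a. a - e) ` S. lcoeff (lpartial s f) a * lcoeff g (m - a))"
  proof (rule lcoeff_times)
    fix a assume "lcoeff (lpartial s f) a \<noteq> 0" "lcoeff g (m - a) \<noteq> 0"
    then have "a + e \<in> S" by (intro S) (auto simp: lpartial.rep_eq e_def)
    then show "a \<in> (\<lambda>a. a - e) ` S" by force
  qed (simp add: fin)
  also have "\<dots> = (\<Sum>a\<in>S. of_int (a $ s) * lcoeff f a * lcoeff g (m + e - a))"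
    by (subst sum.reindex)
      (auto simp: inj_on_def lpartial.rep_eq e e_def[symmetric] algebra_simps intro!: sum.cong)
  finally have 2: "lcoeff (lpartial s f * g) m =
    (\<Sum>a\<in>S. of_int (a $ s) * lcoeff f a * lcoeff g (m + e - a))" .
  have "lcoeff (f * lpartial s g) m = (\<Sum>a\<in>S. lcoeff f a * lcoeff (lpartial s g) (m - a))"
    by (rule lcoeff_times[OF fin], rule S)
      (auto simp: lpartial.rep_eq e_def[symmetric] algebra_simps)
  also have "\<dots> = (\<Sum>a\<in>S. of_int (m $ s + 1 - a $ s) * lcoeff f a * lcoeff g (m + e - a))"
    by (intro sum.cong) (auto simp: lpartial.rep_eq e_def[symmetric] algebra_simps)
  finally have 3: "lcoeff (f * lpartial s g) m =
    (\<Sum>a\<in>S. of_int (m $ s + 1 - a $ s) * lcoeff f a * lcoeff g (m + e - a))" .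
  \<comment> \<open>The exponent \<open>m $ s + 1\<close> splits as \<open>a $ s + (m $ s + 1 - a $ s)\<close> in each summand.\<close>
  show "lcoeff (lpartial s (f * g)) m = lcoeff (lpartial s f * g + f * lpartial s g) m"
    unfolding plus_laurent.rep_eq 2 3 unfolding lpartial.rep_eq e_def[symmetric] 1
      sum_distrib_left sum.distrib[symmetric]
    by (intro sum.cong) (simp_all add: algebra_simps)
qed

lemma lrename_add: "lrename \<rho> (f + g) = lrename \<rho> f + lrename \<rho> g"
  by (rule laurent_eqI) (auto simp: plus_laurent.rep_eq lrename.rep_eq)

lemma lrename_minus: "lrename \<rho> (f - g) = lrename \<rho> f - lrename \<rho> g"
  by (rule laurent_eqI) (auto simp: lcoeff_minus lrename.rep_eq)

lemma lrename_scaleR: "lrename \<rho> (c *\<^sub>R f) = c *\<^sub>R lrename \<rho> f"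
  by (rule laurent_eqI) (auto simp: scaleR_laurent.rep_eq lrename.rep_eq)

lemma lrename_zero: "lrename \<rho> 0 = 0"
  by (rule laurent_eqI) (simp add: zero_laurent.rep_eq lrename.rep_eq)

lemma lrename_sum: "lrename \<rho> (sum f A) = (\<Sum>x\<in>A. lrename \<rho> (f x))"
  by (induction A rule: infinite_finite_induct) (simp_all add: lrename_zero lrename_add)

lemma lrename_mult:
  fixes \<rho> :: "'v::finite \<Rightarrow> 'w::finite"
  assumes "inj \<rho>"
  shows "lrename \<rho> (f * g) = lrename \<rho> f * lrename \<rho> g"
proof (rule laurent_eqI)
  fix m :: "int^'w"
  define Z where "Z x \<longleftrightarrow> (\<forall>j. j \<notin> range \<rho> \<longrightarrow> x $ j = 0)" for x :: "int^'w"
  define p where "p x = (\<chi> i. x $ \<rho> i)" for x :: "int^'w"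
  \<comment> \<open>\<open>q\<close> extends an exponent vector by zero; it is inverse to the restriction \<open>p\<close> on the
      vectors satisfying \<open>Z\<close>.\<close>
  define q where "q y = (\<chi> j. if j \<in> range \<rho> then y $ inv \<rho> j else 0)" for y :: "int^'v"
  have pq: "p (q y) = y" for y using assms by (simp add: p_def q_def vec_eq_iff)
  have qp: "q (p x) = x" if "Z x" for x
    using that by (auto simp: p_def q_def Z_def vec_eq_iff f_inv_into_f)
  have Zq: "Z (q y)" for y by (simp add: Z_def q_def)
  have pdiff: "p (x - y) = p x - p y" for x y by (simp add: p_def vec_eq_iff)
  have Zdiff: "Z x \<Longrightarrow> Z y \<Longrightarrow> Z (x - y)" for x y by (simp add: Z_def)
  have ren: "lcoeff (lrename \<rho> h) x = (if Z x then lcoeff h (p x) else 0)" for h x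
    by (auto simp: lrename.rep_eq Z_def p_def)
  show "lcoeff (lrename \<rho> (f * g)) m = lcoeff (lrename \<rho> f * lrename \<rho> g) m"
  proof (cases "Z m")
    case True
    show ?thesis
      unfolding ren times_laurent.rep_eq if_P[OF True]
      by (rule sum.reindex_bij_witness[of _ p q])
        (auto simp: pq qp Zq pdiff Zdiff True split: if_splits)
  next
    case False
    have "\<not> (Z a \<and> Z (m - a))" for a
      using False unfolding Z_def by (metis vector_minus_component diff_zero)
    then have "{a. lcoeff (lrename \<rho> f) a \<noteq> 0 \<and> lcoeff (lrename \<rho> g) (m - a) \<noteq> 0} = {}"
      by (auto simp: ren)
    then show ?thesis using False ren[of "f * g" m] by (simp only: times_laurent.rep_eq) simp
  qed
qed

lemma lrename_lrename:
  fixes \<sigma> :: "'w::finite \<Rightarrow> 'x::finite"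
  assumes "inj \<sigma>"
  shows "lrename \<sigma> (lrename \<rho> f) = lrename (\<sigma> \<circ> \<rho>) f"
proof (rule laurent_eqI)
  fix m :: "int^'x"
  have "(\<forall>j. j \<notin> range (\<sigma> \<circ> \<rho>) \<longrightarrow> m $ j = 0) \<longleftrightarrow>
    (\<forall>j. j \<notin> range \<sigma> \<longrightarrow> m $ j = 0) \<and> (\<forall>i. i \<notin> range \<rho> \<longrightarrow> m $ \<sigma> i = 0)"
    (is "?L \<longleftrightarrow> ?R")
  proof
    assume ?L
    moreover have "\<sigma> i \<notin> range (\<sigma> \<circ> \<rho>)" if "i \<notin> range \<rho>" for i
      using that assms by (auto simp: inj_eq)
    ultimately show ?R by auto
  next
    assume ?R
    show ?L
    proof (intro allI impI)
      fix j assume j: "j \<notin> range (\<sigma> \<circ> \<rho>)"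
      show "m $ j = 0"
      proof (cases "j \<in> range \<sigma>")
        case True
        then obtain i where "j = \<sigma> i" by blast
        with j have "i \<notin> range \<rho>" by auto
        with \<open>?R\<close> \<open>j = \<sigma> i\<close> show ?thesis by blast
      qed (use \<open>?R\<close> in blast)
    qed
  qed
  then show "lcoeff (lrename \<sigma> (lrename \<rho> f)) m = lcoeff (lrename (\<sigma> \<circ> \<rho>) f) m"
    by (auto simp: lrename.rep_eq)
qed

lemma lpartial_lrename:
  fixes \<rho> :: "'v::finite \<Rightarrow> 'w::finite"
  assumes "inj \<rho>"
  shows "lpartial (\<rho> s) (lrename \<rho> f) = lrename \<rho> (lpartial s f)"
proof (rule laurent_eqI)
  fix m :: "int^'w"
  have "(\<chi> i. (m + axis (\<rho> s) 1) $ \<rho> i) = (\<chi> i. m $ \<rho> i) + axis s 1"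
    using assms by (simp add: vec_eq_iff axis_def inj_eq)
  moreover have "(\<forall>j. j \<notin> range \<rho> \<longrightarrow> (m + axis (\<rho> s) 1) $ j = 0) \<longleftrightarrow>
      (\<forall>j. j \<notin> range \<rho> \<longrightarrow> m $ j = 0)"
    by (auto simp: axis_def)
  ultimately show "lcoeff (lpartial (\<rho> s) (lrename \<rho> f)) m = lcoeff (lrename \<rho> (lpartial s f)) m"
    by (simp only: lpartial.rep_eq lrename.rep_eq) auto
qed

lemma lpartial_lrename_other:
  assumes "t \<notin> range \<rho>"
  shows "lpartial t (lrename \<rho> f) = 0"
proof (rule laurent_eqI)
  fix m
  show "lcoeff (lpartial t (lrename \<rho> f)) m = lcoeff 0 m"
  proof (cases "\<forall>j. j \<notin> range \<rho> \<longrightarrow> (m + axis t 1) $ j = 0")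
    case True
    \<comment> \<open>Then \<open>m $ t = -1\<close>, so the integer factor in the derivative vanishes.\<close>
    with assms have "m $ t + 1 = 0" by (auto simp: axis_def)
    then show ?thesis by (simp add: lpartial.rep_eq zero_laurent.rep_eq)
  next
    case False
    then show ?thesis
      unfolding lpartial.rep_eq lrename.rep_eq if_not_P[OF False] by (simp add: zero_laurent.rep_eq)
  qed
qed

text \<open>
  Here \<open>a\<close> and \<open>b\<close> choose the groups of variables that are substituted for \<open>u\<close> and \<open>v\<close> in
  \<open>\<phi> i j u v\<close>.
\<close>

lemma lrename_case_sum_phi:
  assumes "inj (case_sum a b)"
  shows "lrename (case_sum a b) (lrename Inl f * lrename Inr g - lrename Inr h * lrename Inl l)
    = lrename a f * lrename b g - lrename b h * lrename a l"
  using assms by (simp add: lrename_minus lrename_mult lrename_lrename comp_def)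

lemma lpartial_phi:
  assumes "inj a" and "\<And>x y. a x \<noteq> b y"
  shows "lpartial (a s) (lrename a f * lrename b g - lrename b h * lrename a l)
    = lrename a (lpartial s f) * lrename b g - lrename b h * lrename a (lpartial s l)"
proof -
  have "a s \<notin> range b" using assms(2) by auto
  then show ?thesis
    by (simp add: lpartial_minus lpartial_mult lpartial_lrename[OF assms(1)]
        lpartial_lrename_other)
qed

lemma laurent_CYBE_solution_of_bracket:
  fixes \<Psi> \<Theta> :: "'n::finite \<Rightarrow> 'n laurent"
  assumes bracket: "\<And>i. (\<Sum>s\<in>UNIV. \<Psi> s * lpartial s (\<Theta> i) - \<Theta> s * lpartial s (\<Psi> i))
    = \<alpha> *\<^sub>R \<Theta> i + \<beta> *\<^sub>R \<Psi> i"
  shows "laurent_CYBE_solution (\<lambda>i j. lrename Inl (\<Theta> i) * lrename Inr (\<Psi> j)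
    - lrename Inr (\<Theta> j) * lrename Inl (\<Psi> i))"
proof -
  have bracket_ren: "(\<Sum>s\<in>UNIV. lrename a (\<Psi> s) * lrename a (lpartial s (\<Theta> i))
        - lrename a (\<Theta> s) * lrename a (lpartial s (\<Psi> i)))
      = \<alpha> *\<^sub>R lrename a (\<Theta> i) + \<beta> *\<^sub>R lrename a (\<Psi> i)"
    if "inj a" for a :: "'n \<Rightarrow> 'n + 'n + 'n" and i
    using arg_cong[OF bracket[of i], of "lrename a"]
    by (simp only: lrename_sum lrename_minus lrename_mult[OF that] lrename_add lrename_scaleR)
  define u v w :: "'n \<Rightarrow> 'n + 'n + 'n"
    where "u = (\<lambda>s. Inl s)" and "v = (\<lambda>s. Inr (Inl s))" and "w = (\<lambda>s. Inr (Inr s))"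
  then have uvw: "Inl s = u s" "Inr (Inl s) = v s" "Inr (Inr s) = w s" for s
    by simp_all
  have inj: "inj u" "inj v" "inj w"
    by (auto simp: uvw[symmetric] inj_def)
  have ne: "u x \<noteq> v y" "v x \<noteq> u y" "u x \<noteq> w y" "w x \<noteq> u y" "v x \<noteq> w y" "w x \<noteq> v y" for x y
    by (auto simp: uvw[symmetric])
  have inj2: "inj (case_sum u v)" "inj (case_sum v u)" "inj (case_sum u w)"
    "inj (case_sum w u)" "inj (case_sum v w)" "inj (case_sum w v)"
    by (auto simp: uvw[symmetric] inj_def split: sum.splits)
  have swap: "inj (case_sum Inr Inl :: 'n + 'n \<Rightarrow> 'n + 'n)"
    by (auto simp: inj_def split: sum.splits)
  \<comment> \<open>After \<open>\<phi>\<close> and its derivatives are expanded, the equation is literally the conclusion of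
      \<open>CYBE_of_bracket_relation\<close>; only the skew-symmetry of \<open>\<phi>\<close> is left to the simplifier.\<close>
  show ?thesis
    unfolding laurent_CYBE_solution_def Let_def
    unfolding uvw lrename_case_sum_phi[OF swap]
      inj2[THEN lrename_case_sum_phi]
    unfolding lpartial_phi[OF inj(1) ne(1)] lpartial_phi[OF inj(1) ne(3)]
      lpartial_phi[OF inj(2) ne(2)] lpartial_phi[OF inj(2) ne(5)]
      lpartial_phi[OF inj(3) ne(4)] lpartial_phi[OF inj(3) ne(6)]
    by (intro conjI allI; (rule CYBE_of_bracket_relation; rule bracket_ren; rule inj)?)
      (simp add: mult.commute)
qed

section \<open>Smooth functions\<close>

text \<open>
  Wherever \<open>S\<close> is assumed to be open below, this serves to pass from equality of two functions on
  \<open>S\<close> to equality of their derivatives there, since \<open>frechet_derivative\<close> is taken at a point of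
  the whole space.
\<close>

lemma C_diff_on_cong:
  assumes "open S" "\<And>x. x \<in> S \<Longrightarrow> f x = g x" "C_diff_on k S f"
  shows "C_diff_on k S g"
  using assms(2,3)
proof (induction k arbitrary: f g)
  case 0
  then show ?case using continuous_on_cong[of S S f g] by simp
next
  case (Suc k)
  have deriv: "(g has_derivative frechet_derivative f (at x)) (at x)" if "x \<in> S" for x
    using Suc.prems that assms(1)
    by (intro has_derivative_transform_within_open[of f _ _ _ S g])
       (auto simp: frechet_derivative_works)
  have "C_diff_on k S (\<lambda>x. frechet_derivative g (at x) h)" for h
  proof (rule Suc.IH)
    show "C_diff_on k S (\<lambda>x. frechet_derivative f (at x) h)" using Suc.prems by simp
  qed (simp add: frechet_derivative_at[OF deriv])
  then show ?case using deriv by (auto simp: differentiable_def)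
qed

text \<open>The induction step shared by the closure properties of \<open>C_diff_on\<close>.\<close>

lemma C_diff_on_SucI:
  assumes "open S" "\<And>x. x \<in> S \<Longrightarrow> (f has_derivative f' x) (at x)"
    and "\<And>h. C_diff_on k S (\<lambda>x. f' x h)"
  shows "C_diff_on (Suc k) S f"
proof -
  have "C_diff_on k S (\<lambda>x. frechet_derivative f (at x) h)" for h
    by (rule C_diff_on_cong[OF assms(1) _ assms(3)])
      (simp add: frechet_derivative_at[OF assms(2)])
  then show ?thesis using assms(2) by (auto simp: differentiable_def)
qed

lemma C_diff_on_Suc_derivative:
  "C_diff_on (Suc k) S f \<Longrightarrow> x \<in> S \<Longrightarrow> (f has_derivative frechet_derivative f (at x)) (at x)"
  by (simp add: frechet_derivative_works)

lemma C_diff_on_SucD: "C_diff_on (Suc k) S f \<Longrightarrow> C_diff_on k S f"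
proof (induction k arbitrary: f)
  case 0
  then show ?case
    by (auto intro!: continuous_at_imp_continuous_on differentiable_imp_continuous_within)
next
  case (Suc k)
  then show ?case by (metis C_diff_on.simps(2))
qed

lemma C_diff_on_add:
  assumes "open S" "C_diff_on k S f" "C_diff_on k S g"
  shows "C_diff_on k S (\<lambda>x. f x + g x)"
  using assms(2,3)
proof (induction k arbitrary: f g)
  case 0
  then show ?case by (auto intro: continuous_intros)
next
  case (Suc k)
  show ?case
    by (rule C_diff_on_SucI[OF assms(1) has_derivative_add])
      (use Suc in \<open>auto intro: C_diff_on_Suc_derivative\<close>)
qed

lemma C_diff_on_diff:
  assumes "open S" "C_diff_on k S f" "C_diff_on k S g"
  shows "C_diff_on k S (\<lambda>x. f x - g x)"
  using assms(2,3)
proof (induction k arbitrary: f g)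
  case 0
  then show ?case by (auto intro: continuous_intros)
next
  case (Suc k)
  show ?case
    by (rule C_diff_on_SucI[OF assms(1) has_derivative_diff])
      (use Suc in \<open>auto intro: C_diff_on_Suc_derivative\<close>)
qed

lemma C_diff_on_mult:
  assumes "open S" "C_diff_on k S f" "C_diff_on k S g"
  shows "C_diff_on k S (\<lambda>x. f x * g x)"
  using assms(2,3)
proof (induction k arbitrary: f g)
  case 0
  then show ?case by (auto intro: continuous_intros)
next
  case (Suc k)
  show ?case
  proof (rule C_diff_on_SucI[OF assms(1) has_derivative_mult])
    fix h
    show "C_diff_on k S (\<lambda>x. f x * frechet_derivative g (at x) h
                            + frechet_derivative f (at x) h * g x)"
      using Suc.prems C_diff_on_SucD[OF Suc.prems(1)] C_diff_on_SucD[OF Suc.prems(2)]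
      by (intro C_diff_on_add[OF assms(1)] Suc.IH) auto
  qed (use Suc.prems in \<open>auto intro: C_diff_on_Suc_derivative\<close>)
qed

lemma C_diff_on_compose_linear:
  assumes "open S" "bounded_linear L" "L ` S \<subseteq> T" "C_diff_on k T f"
  shows "C_diff_on k S (\<lambda>x. f (L x))"
  using assms(4)
proof (induction k arbitrary: f)
  case 0
  then show ?case
    using continuous_on_compose2[of T f S L] assms(3)
      linear_continuous_on[OF assms(2)] by simp
next
  case (Suc k)
  show ?case
  proof (rule C_diff_on_SucI[OF assms(1)])
    fix x assume "x \<in> S"
    then have "L x \<in> T" using assms(3) by auto
    then show "((\<lambda>x. f (L x)) has_derivative (\<lambda>h. frechet_derivative f (at (L x)) (L h))) (at x)"
      using has_derivative_compose[OF bounded_linear_imp_has_derivative[OF assms(2)]]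
        C_diff_on_Suc_derivative[OF Suc.prems] by blast
  next
    fix h
    show "C_diff_on k S (\<lambda>x. frechet_derivative f (at (L x)) (L h))"
      using Suc.prems by (intro Suc.IH) simp
  qed
qed

lemma smooth_on_differentiable: "smooth_on S f \<Longrightarrow> x \<in> S \<Longrightarrow> f differentiable (at x)"
  unfolding smooth_on_def by (metis C_diff_on.simps(2))

lemma partial_phi:
  assumes "f differentiable (at x)" "g differentiable (at x)"
  shows "partial s (\<lambda>x. f x * c - d * g x) x = partial s f x * c - d * partial s g x"
proof -
  have "((\<lambda>x. f x * c - d * g x) has_derivative
      (\<lambda>h. frechet_derivative f (at x) h * c - d * frechet_derivative g (at x) h)) (at x)"
    using assms unfolding frechet_derivative_works by (auto intro!: derivative_eq_intros)
  from frechet_derivative_at[OF this, symmetric] show ?thesis by (simp add: partial_def)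
qed

lemma smooth_on_phi:
  assumes "open U" "smooth_on U f" "smooth_on U g" "smooth_on U h" "smooth_on U l"
  shows "smooth_on (U \<times> U) (\<lambda>(u, v). f u * g v - h v * l u)"
  unfolding smooth_on_def case_prod_beta
proof
  fix k
  have op: "open (U \<times> U)" using assms(1) by (rule open_Times) fact
  show "C_diff_on k (U \<times> U) (\<lambda>p. f (fst p) * g (snd p) - h (snd p) * l (fst p))"
    using assms(2-5)[unfolded smooth_on_def, rule_format, of k]
    by (intro C_diff_on_diff C_diff_on_mult op
        C_diff_on_compose_linear[OF op bounded_linear_fst, of U]
        C_diff_on_compose_linear[OF op bounded_linear_snd, of U]) auto
qed

lemma smooth_CYBE_solution_of_bracket:
  fixes \<Psi> \<Theta> :: "'n::finite \<Rightarrow> real^'n \<Rightarrow> real"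
  assumes "open U" "\<And>i. smooth_on U (\<Psi> i)" "\<And>i. smooth_on U (\<Theta> i)"
    and bracket: "\<And>i u. u \<in> U \<Longrightarrow>
      (\<Sum>s\<in>UNIV. \<Psi> s u * partial s (\<Theta> i) u - \<Theta> s u * partial s (\<Psi> i) u)
        = \<alpha> * \<Theta> i u + \<beta> * \<Psi> i u"
  shows "smooth_CYBE_solution U (\<lambda>i j u v. \<Theta> i u * \<Psi> j v - \<Theta> j v * \<Psi> i u)"
proof -
  note diff = smooth_on_differentiable[OF assms(2)] smooth_on_differentiable[OF assms(3)]
  have bracket': "(\<Sum>s\<in>UNIV. \<Psi> s u * partial s (\<Theta> i) u - \<Theta> s u * partial s (\<Psi> i) u)
      = \<alpha> *\<^sub>R \<Theta> i u + \<beta> *\<^sub>R \<Psi> i u" if "u \<in> U" for i u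
    using bracket[OF that] by simp
  show ?thesis
    unfolding smooth_CYBE_solution_def
  proof (intro conjI allI ballI)
    fix i j k u v w
    assume [simp]: "u \<in> U" "v \<in> U" "w \<in> U"
    show "(\<Sum>s\<in>UNIV.
        (\<Theta> k w * \<Psi> s u - \<Theta> s u * \<Psi> k w) * partial s (\<lambda>u. \<Theta> i u * \<Psi> j v - \<Theta> j v * \<Psi> i u) u
      + (\<Theta> s v * \<Psi> k w - \<Theta> k w * \<Psi> s v) * partial s (\<lambda>v. \<Theta> j v * \<Psi> i u - \<Theta> i u * \<Psi> j v) v
      + (\<Theta> i u * \<Psi> s v - \<Theta> s v * \<Psi> i u) * partial s (\<lambda>v. \<Theta> j v * \<Psi> k w - \<Theta> k w * \<Psi> j v) v
      + (\<Theta> s w * \<Psi> i u - \<Theta> i u * \<Psi> s w) * partial s (\<lambda>w. \<Theta> k w * \<Psi> j v - \<Theta> j v * \<Psi> k w) w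
      + (\<Theta> j v * \<Psi> s w - \<Theta> s w * \<Psi> j v) * partial s (\<lambda>w. \<Theta> k w * \<Psi> i u - \<Theta> i u * \<Psi> k w) w
      + (\<Theta> s u * \<Psi> j v - \<Theta> j v * \<Psi> s u) * partial s (\<lambda>u. \<Theta> i u * \<Psi> k w - \<Theta> k w * \<Psi> i u) u)
      = 0"
      unfolding partial_phi[OF diff(2,1), OF \<open>u \<in> U\<close> \<open>u \<in> U\<close>]
        partial_phi[OF diff(2,1), OF \<open>v \<in> U\<close> \<open>v \<in> U\<close>]
        partial_phi[OF diff(2,1), OF \<open>w \<in> U\<close> \<open>w \<in> U\<close>]
      by (rule CYBE_of_bracket_relation; rule bracket') simp_all
  qed (use smooth_on_phi[OF assms(1)] assms(2,3) in auto)
qed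

section \<open>Solutions of the Yang--Baxter equation from a bracket relation\<close>

theorem theorem3p2:
  fixes \<alpha> \<beta> :: real
  shows
    "(\<forall>\<Psi> \<Theta> :: 'n::finite \<Rightarrow> 'n laurent.
        (\<forall>i. (\<Sum>s\<in>UNIV. \<Psi> s * lpartial s (\<Theta> i) - \<Theta> s * lpartial s (\<Psi> i))
              = \<alpha> *\<^sub>R \<Theta> i + \<beta> *\<^sub>R \<Psi> i)
        \<longrightarrow> laurent_CYBE_solution
              (\<lambda>i j. lrename Inl (\<Theta> i) * lrename Inr (\<Psi> j)
                   - lrename Inr (\<Theta> j) * lrename Inl (\<Psi> i)))
   \<and> (\<forall>(U :: (real^'n) set) (\<Psi> :: 'n \<Rightarrow> real^'n \<Rightarrow> real) (\<Theta> :: 'n \<Rightarrow> real^'n \<Rightarrow> real).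
        open U \<longrightarrow>
        (\<forall>i. smooth_on U (\<Psi> i)) \<longrightarrow>
        (\<forall>i. smooth_on U (\<Theta> i)) \<longrightarrow>
        (\<forall>i. \<forall>u\<in>U. (\<Sum>s\<in>UNIV. \<Psi> s u * partial s (\<Theta> i) u - \<Theta> s u * partial s (\<Psi> i) u)
              = \<alpha> * \<Theta> i u + \<beta> * \<Psi> i u)
        \<longrightarrow> smooth_CYBE_solution U (\<lambda>i j u v. \<Theta> i u * \<Psi> j v - \<Theta> j v * \<Psi> i u))"
  using laurent_CYBE_solution_of_bracket smooth_CYBE_solution_of_bracket by blast

end
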